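(* Let $1 \le r \le n$ be integers and let $\lambda = 1^{e_1}2^{e_2}\cdots$ be a partition of $n-r$ (with $e_i$ the number of parts equal to $i$), and set $e_0 = n - e_1 - e_2 - \cdots$. Then the number of rooted labeled forests on the vertex set $\{1,2,\ldots,n\}$ with roots $1,2,\ldots,r$ whose type with respect to the local orientation is $\lambda$ equals $$\frac{r\,(n-1)!\,(n-r)!}{e_0!(0!)^{e_0}e_1!(1!)^{e_1}e_2!(2!)^{e_2}\cdots}.$$
   Context: A rooted labeled forest on $\{1,\ldots,n\}$ with roots $1,\ldots,r$ is a forest (acyclic graph) on vertex set $\{1,\ldots,n\}$ with exactly $r$ connected components, each containing exactly one of the vertices $1,\ldots,r$ (which serves as that component's root). In the local orientation, every edge is oriented from the endpoint with the smaller label towards the endpoint with the larger label; the (local) indegree of a vertex $i$ is thus the number of its neighbours with label smaller than $i$. The type of such a forest is the partition $1^{e_1}2^{e_2}\cdots$ of the number of edges $n-r$, where $e_i$ ($i\ge1$) is the number of vertices of indegree $i$. *)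

theory Defs
  imports Complex_Main "HOL-Library.Multiset"
begin

text \<open>
  A simple graph is given by a finite vertex set and a set of edges, each edge being an
  unordered pair of distinct vertices.
\<close>

definition simple_graph :: "'a set \<Rightarrow> 'a set set \<Rightarrow> bool" where
  "simple_graph V E \<longleftrightarrow> finite V \<and> (\<forall>e\<in>E. e \<subseteq> V \<and> card e = 2)"

definition adj_rel :: "'a set set \<Rightarrow> ('a \<times> 'a) set" where
  "adj_rel E = {(u, v). {u, v} \<in> E}"

text \<open>Restricting to \<open>V \<times> V\<close> makes isolated vertices singleton components.\<close>

definition connected_components :: "'a set \<Rightarrow> 'a set set \<Rightarrow> 'a set set" where
  "connected_components V E = V // ((adj_rel E)\<^sup>* \<inter> V \<times> V)"

text \<open>A cycle is listed without repeating its starting vertex.\<close>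

definition is_cycle :: "'a set set \<Rightarrow> 'a list \<Rightarrow> bool" where
  "is_cycle E vs \<longleftrightarrow> length vs \<ge> 3 \<and> distinct vs \<and>
     (\<forall>i. Suc i < length vs \<longrightarrow> {vs ! i, vs ! Suc i} \<in> E) \<and> {last vs, hd vs} \<in> E"

definition is_forest :: "'a set \<Rightarrow> 'a set set \<Rightarrow> bool" where
  "is_forest V E \<longleftrightarrow> simple_graph V E \<and> \<not> (\<exists>vs. is_cycle E vs)"

definition rooted_labeled_forest :: "nat \<Rightarrow> nat \<Rightarrow> nat set set \<Rightarrow> bool" where
  "rooted_labeled_forest n r E \<longleftrightarrow>
     is_forest {1..n} E \<and>
     card (connected_components {1..n} E) = r \<and>
     (\<forall>C \<in> connected_components {1..n} E. \<exists>!v. v \<in> C \<and> v \<in> {1..r})"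

definition local_arcs :: "nat set set \<Rightarrow> (nat \<times> nat) set" where
  "local_arcs E = {(u, v). {u, v} \<in> E \<and> u < v}"

definition local_indegree :: "nat set set \<Rightarrow> nat \<Rightarrow> nat" where
  "local_indegree E v = card {u. (u, v) \<in> local_arcs E}"

text \<open>
  Partitions are multisets of positive integers, \<open>count lam i\<close> being the multiplicity \<open>e\<^sub>i\<close> of
  the part \<open>i\<close>.
\<close>

definition is_partition :: "nat \<Rightarrow> nat multiset \<Rightarrow> bool" where
  "is_partition N lam \<longleftrightarrow> (\<forall>i \<in># lam. i \<ge> 1) \<and> sum_mset lam = N"

text \<open>Vertices of indegree \<open>0\<close> contribute no part to the type.\<close>

definition local_type :: "nat \<Rightarrow> nat set set \<Rightarrow> nat multiset" where
  "local_type n E =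
     filter_mset (\<lambda>d. d \<ge> 1) (image_mset (local_indegree E) (mset_set {1..n}))"

end

theory Submission
  imports Defs "HOL-Library.Poly_Mapping"
begin

text \<open>
  Weight a forest by the product of \<open>x\<^sub>d\<close> over its vertices, \<open>d\<close> being the local indegree, and
  consider forests with an arbitrary root set \<open>R\<close> on an arbitrary finite vertex set \<open>V\<close> of
  naturals. A tree may be rerooted at the largest vertex \<open>n\<close>, whose local indegree is its degree;
  deleting \<open>n\<close> leaves a forest rooted at the former neighbours of \<open>n\<close>, with all other local
  indegrees unchanged. A forest with several roots splits into the component of one root and a
  forest on the remaining vertices. Hence the total weight depends only on \<open>|V - R|\<close> and \<open>|R|\<close>,
  and it satisfies the recurrence that governs indegrees with respect to edges oriented towards the
  root. Taking for \<open>x\<^sub>d\<close> the monomial \<open>{#d#}\<close> in the monoid algebra of multisets, the coefficients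
  of this recurrence are computed by induction.
\<close>

section \<open>Forests and bridges\<close>

definition conn :: "'a set set \<Rightarrow> 'a \<Rightarrow> 'a \<Rightarrow> bool" where
  "conn E u v \<longleftrightarrow> (u, v) \<in> (adj_rel E)\<^sup>*"

lemma conn_refl [simp]: "conn E u u"
  by (simp add: conn_def)

lemma conn_trans [trans]: "conn E u v \<Longrightarrow> conn E v w \<Longrightarrow> conn E u w"
  by (simp add: conn_def)

lemma conn_edge: "{u, v} \<in> E \<Longrightarrow> conn E u v"
  by (auto simp: conn_def adj_rel_def)

lemma sym_adj_rel: "sym (adj_rel E)"
  by (auto simp: sym_def adj_rel_def insert_commute)

lemma conn_sym: "conn E u v \<Longrightarrow> conn E v u"
  unfolding conn_def by (meson sym_adj_rel sym_rtrancl symD)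

lemma conn_commute: "conn E u v \<longleftrightarrow> conn E v u"
  by (metis conn_sym)

lemma conn_mono: "conn E u v \<Longrightarrow> E \<subseteq> E' \<Longrightarrow> conn E' u v"
  unfolding conn_def by (rule subsetD[OF rtrancl_mono]) (auto simp: adj_rel_def)

lemma conn_induct [consumes 1, case_names refl step]:
  assumes "conn E u v" "P u" "\<And>y z. conn E u y \<Longrightarrow> {y, z} \<in> E \<Longrightarrow> P y \<Longrightarrow> P z"
  shows "P v"
  using assms(1) unfolding conn_def
  by (induction rule: rtrancl_induct) (auto intro: assms simp: conn_def adj_rel_def)

text \<open>A walk through the new edge can be shortened to cross it at most once, in one of two
  directions. In the induction an old edge extends the current case, and the new edge moves between
  the cases.\<close>

lemma conn_insert_edge:
  "conn (insert {u, v} E) x y \<longleftrightarrow>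
     conn E x y \<or> conn E x u \<and> conn E v y \<or> conn E x v \<and> conn E u y" (is "?L \<longleftrightarrow> ?R")
proof
  assume ?L
  then show ?R
  proof (induction rule: conn_induct)
    case refl
    then show ?case by simp
  next
    case (step y z)
    then consider "{y, z} \<in> E" | "y = u" "z = v" | "y = v" "z = u"
      by (auto simp: doubleton_eq_iff)
    then show ?case
    proof cases
      case 1
      then show ?thesis using step.IH conn_edge[OF 1] by (meson conn_trans)
    qed (use step.IH in auto)
  qed
next
  have *: "conn E a b \<Longrightarrow> conn (insert {u, v} E) a b" for a b
    by (erule conn_mono) auto
  have "conn (insert {u, v} E) u v"
    by (rule conn_edge) simp
  then show "?R \<Longrightarrow> ?L"
    by (meson * conn_sym conn_trans)
qed

text \<open>Acyclicity phrased through reachability: every edge is a bridge. The effect of adding an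
  edge can then be read off from \<open>conn_insert_edge\<close>, with no cycles to
  manipulate.\<close>

definition bridges :: "'a set set \<Rightarrow> bool" where
  "bridges E \<longleftrightarrow> (\<forall>u v. {u, v} \<in> E \<longrightarrow> \<not> conn (E - {{u, v}}) u v)"

lemma bridges_subset: "bridges E \<Longrightarrow> E' \<subseteq> E \<Longrightarrow> bridges E'"
  unfolding bridges_def by (meson Diff_mono conn_mono order_refl subsetD)

lemma bridges_insert:
  assumes "{u, v} \<notin> E"
  shows "bridges (insert {u, v} E) \<longleftrightarrow> bridges E \<and> \<not> conn E u v"
proof
  assume "bridges (insert {u, v} E)"
  then show "bridges E \<and> \<not> conn E u v"
    using assms bridges_subset[of "insert {u, v} E" E] by (auto simp: bridges_def)
next
  assume *: "bridges E \<and> \<not> conn E u v"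
  show "bridges (insert {u, v} E)"
    unfolding bridges_def
  proof (intro allI impI)
    fix a b
    assume ab: "{a, b} \<in> insert {u, v} E"
    show "\<not> conn (insert {u, v} E - {{a, b}}) a b"
    proof (cases "{a, b} = {u, v}")
      case True
      then show ?thesis
        using * assms by (auto simp: doubleton_eq_iff insert_commute dest: conn_sym)
    next
      case False
      then have abE: "{a, b} \<in> E" using ab by auto
      have eq: "insert {u, v} E - {{a, b}} = insert {u, v} (E - {{a, b}})" using False by auto
      have up: "conn (E - {{a, b}}) c d \<Longrightarrow> conn E c d" for c d
        by (erule conn_mono) auto
      \<comment> \<open>A detour replacing the old edge \<open>{a, b}\<close> would run through the
        new edge; completed by \<open>{a, b}\<close> itself it would join \<open>u\<close> to
        \<open>v\<close> in \<open>E\<close>.\<close>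
      show ?thesis
        unfolding eq conn_insert_edge
        using * abE up conn_edge[OF abE] by (meson bridges_def conn_sym conn_trans)
    qed
  qed
qed

text \<open>The walk is kept a path during the induction: a step back to a vertex already visited
  truncates the list at that vertex.\<close>

lemma conn_path:
  assumes "conn E u v"
  shows "\<exists>p. p \<noteq> [] \<and> distinct p \<and> hd p = u \<and> last p = v \<and> (\<forall>i. Suc i < length p \<longrightarrow> {p ! i, p ! Suc i} \<in> E)"
  using assms
proof (induction rule: conn_induct)
  case refl
  show ?case by (rule exI[of _ "[u]"]) auto
next
  case (step y z)
  then obtain p where p: "p \<noteq> []" "distinct p" "hd p = u" "last p = y"
      "\<And>i. Suc i < length p \<Longrightarrow> {p ! i, p ! Suc i} \<in> E" by blast
  show ?case
  proof (cases "z \<in> set p")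
    case True
    then obtain j where j: "j < length p" "p ! j = z" by (auto simp: in_set_conv_nth)
    have "last (take (Suc j) p) = z" using j by (simp add: take_Suc_conv_app_nth)
    then show ?thesis
      by (intro exI[of _ "take (Suc j) p"]) (use p j in auto)
  next
    case False
    have "{(p @ [z]) ! i, (p @ [z]) ! Suc i} \<in> E" if "Suc i < length (p @ [z])" for i
    proof (cases "Suc i < length p")
      case True
      then show ?thesis using p(5) by (auto simp: nth_append)
    next
      case False
      then have "i = length p - 1" "i < length p" using that p(1) by auto
      then show ?thesis using step p by (auto simp: nth_append last_conv_nth)
    qed
    then show ?thesis
      by (intro exI[of _ "p @ [z]"]) (use p False in auto)
  qed
qed

text \<open>A path that joins the ends of an edge and avoids it closes up to a cycle; conversely, a
  cycle without its closing edge still joins the ends of that edge.\<close>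

lemma acyclic_iff_bridges:
  assumes "simple_graph V E"
  shows "(\<nexists>p. is_cycle E p) \<longleftrightarrow> bridges E"
proof
  assume nc: "\<nexists>p. is_cycle E p"
  show "bridges E"
    unfolding bridges_def
  proof (intro allI impI notI)
    fix u v
    assume uv: "{u, v} \<in> E" and "conn (E - {{u, v}}) u v"
    then obtain p where p: "p \<noteq> []" "distinct p" "hd p = u" "last p = v"
        "\<And>i. Suc i < length p \<Longrightarrow> {p ! i, p ! Suc i} \<in> E - {{u, v}}"
      using conn_path by metis
    have "card {u, v} = 2" using assms uv by (auto simp: simple_graph_def)
    then have "u \<noteq> v" by auto
    moreover have "length p \<noteq> 2"
      using p(5)[of 0] p by (auto simp: hd_conv_nth last_conv_nth)
    moreover have "length p \<noteq> 1" using p \<open>u \<noteq> v\<close> by (cases p) auto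
    ultimately have "length p \<ge> 3" using p(1) by (cases "length p"; auto; arith)
    then have "is_cycle E p"
      using p uv by (auto simp: is_cycle_def insert_commute)
    then show False using nc by blast
  qed
next
  assume b: "bridges E"
  show "\<nexists>p. is_cycle E p"
  proof
    assume "\<exists>p. is_cycle E p"
    then obtain p where p: "length p \<ge> 3" "distinct p"
        "\<And>i. Suc i < length p \<Longrightarrow> {p ! i, p ! Suc i} \<in> E" "{last p, hd p} \<in> E"
      by (auto simp: is_cycle_def)
    define e where "e = {last p, hd p}"
    have l: "last p = p ! (length p - 1)" and h: "hd p = p ! 0"
      using p(1) by (cases p; simp add: last_conv_nth)+
    \<comment> \<open>With at least three distinct vertices no step of the list repeats the closing
      edge, so the walk survives its deletion.\<close>
    have ne: "{p ! i, p ! Suc i} \<noteq> e" if i: "Suc i < length p" for i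
      unfolding e_def l h
    proof
      assume "{p ! i, p ! Suc i} = {p ! (length p - 1), p ! 0}"
      then have "p ! i = p ! 0 \<and> p ! Suc i = p ! (length p - 1) \<or> p ! Suc i = p ! 0"
        by (auto simp: doubleton_eq_iff)
      moreover have "0 < length p" "i < length p" "length p - 1 < length p" using i by auto
      ultimately have "i = 0 \<and> Suc i = length p - 1"
        using nth_eq_iff_index_eq[OF p(2)] i by blast
      then have "length p = 2" by arith
      then show False using p(1) by simp
    qed
    have "conn (E - {e}) (hd p) (p ! i)" if "i < length p" for i
      using that
    proof (induction i)
      case 0
      then show ?case by (simp add: h)
    next
      case (Suc i)
      then have "conn (E - {e}) (p ! i) (p ! Suc i)"
        by (intro conn_edge) (use p(3) ne in auto)
      then show ?case using Suc conn_trans Suc_lessD by metis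
    qed
    then have "conn (E - {e}) (last p) (hd p)"
      unfolding l using p(1) by (auto intro!: conn_sym[of _ "hd p"])
    then show False using b p(4) by (auto simp: bridges_def e_def)
  qed
qed

text \<open>Exactly one root per component, split into existence and uniqueness so that the two can
  be followed separately. The root set is arbitrary because deleting a vertex turns its neighbours
  into roots.\<close>

definition rforest :: "'a set \<Rightarrow> 'a set \<Rightarrow> 'a set set \<Rightarrow> bool" where
  "rforest V R E \<longleftrightarrow> simple_graph V E \<and> bridges E \<and> R \<subseteq> V \<and>
     (\<forall>v\<in>V. \<exists>q\<in>R. conn E v q) \<and> (\<forall>p\<in>R. \<forall>q\<in>R. conn E p q \<longrightarrow> p = q)"

lemma unique_root_iff:
  assumes "R \<subseteq> V"
  shows "(\<forall>v\<in>V. \<exists>!q. q \<in> R \<and> conn E v q) \<longleftrightarrow>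
    (\<forall>v\<in>V. \<exists>q\<in>R. conn E v q) \<and> (\<forall>p\<in>R. \<forall>q\<in>R. conn E p q \<longrightarrow> p = q)" (is "?L \<longleftrightarrow> ?R")
proof
  assume L: ?L
  show ?R
  proof (intro conjI ballI impI)
    fix p q assume "p \<in> R" "q \<in> R" "conn E p q"
    then show "p = q" using L assms conn_refl[of E p] by blast
  qed (use L in blast)
next
  assume ?R
  then show ?L by (meson conn_sym conn_trans)
qed

lemma conn_in_vertices:
  assumes "simple_graph V E" "conn E u v" "u \<in> V"
  shows "v \<in> V"
  using assms(2,3,1) by (induction rule: conn_induct) (auto simp: simple_graph_def)

text \<open>When every vertex reaches exactly one root, each component is the class of its root and
  distinct roots have distinct classes; so \<open>K\<close> maps \<open>R\<close> bijectively onto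
  the components, which gives the cardinality.\<close>

lemma components_iff:
  fixes V :: "'a set"
  assumes sg: "simple_graph V E" and R: "R \<subseteq> V"
  shows "card (connected_components V E) = card R \<and> (\<forall>C\<in>connected_components V E. \<exists>!v. v \<in> C \<and> v \<in> R)
    \<longleftrightarrow> (\<forall>v\<in>V. \<exists>!q. q \<in> R \<and> conn E v q)"
proof -
  define K where "K v = {w. conn E v w}" for v
  have cc: "connected_components V E = K ` V"
    using conn_in_vertices[OF sg]
    by (fastforce simp: connected_components_def quotient_def K_def conn_def)
  have "card (K ` V) = card R" if u: "\<forall>v\<in>V. \<exists>!q. q \<in> R \<and> conn E v q"
  proof -
    have "K ` V = K ` R"
    proof
      show "K ` V \<subseteq> K ` R"
      proof safe
        fix v assume "v \<in> V"
        then obtain q where q: "q \<in> R" "conn E v q" using u by blast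
        have "conn E v w \<longleftrightarrow> conn E q w" for w
          by (meson q(2) conn_sym conn_trans)
        then have "K v = K q" by (simp add: K_def)
        then show "K v \<in> K ` R" using q by auto
      qed
    qed (use R in auto)
    moreover have "inj_on K R"
    proof
      fix a b assume ab: "a \<in> R" "b \<in> R" "K a = K b"
      have "b \<in> K a" unfolding ab(3) by (simp add: K_def)
      then have "conn E a b" by (simp add: K_def)
      then show "a = b" using u ab R conn_refl[of E a] by blast
    qed
    ultimately show ?thesis by (simp add: card_image)
  qed
  then show ?thesis unfolding cc by (auto simp: K_def Bex_def)
qed

lemma rooted_labeled_forest_iff:
  assumes "r \<le> n"
  shows "rooted_labeled_forest n r E \<longleftrightarrow> rforest {1..n} {1..r} E"
proof (cases "simple_graph {1..n} E")
  case True
  have "{1..r} \<subseteq> {1..n}" using assms by auto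
  from components_iff[OF True this] unique_root_iff[OF this, of E] show ?thesis
    unfolding rooted_labeled_forest_def rforest_def is_forest_def
    using True assms acyclic_iff_bridges[OF True] by auto
qed (simp add: rooted_labeled_forest_def rforest_def is_forest_def)

section \<open>Elementary operations on rooted forests\<close>

lemma simple_graph_insert:
  "simple_graph V (insert {u, v} E) \<longleftrightarrow> u \<in> V \<and> v \<in> V \<and> u \<noteq> v \<and> simple_graph V E"
  by (auto simp: simple_graph_def card_2_iff doubleton_eq_iff)

lemma finite_rforests: "finite {E. rforest V R E}"
proof (cases "finite V")
  case True
  have "{E. rforest V R E} \<subseteq> Pow (Pow V)"
    by (auto simp: rforest_def simple_graph_def)
  then show ?thesis using True by (meson finite_Pow_iff finite_subset)
qed (simp add: rforest_def simple_graph_def)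

text \<open>Cutting an edge from a root \<open>q\<close> to a non-root \<open>a\<close> detaches the
  subtree at \<open>a\<close>, which becomes a component with root \<open>a\<close>; gluing it back
  leaves \<open>q\<close> as the common root.\<close>

lemma rforest_insert_edge:
  assumes "q \<in> R" "a \<in> V" "a \<notin> R" "{q, a} \<notin> E"
  shows "rforest V R (insert {q, a} E) \<longleftrightarrow> rforest V (insert a R) E"
proof
  assume L: "rforest V R (insert {q, a} E)"
  then have nc: "\<not> conn E q a"
    using bridges_insert[OF assms(4)] by (simp add: rforest_def)
  have uniq: "s = t" if "s \<in> R" "t \<in> R" "conn (insert {q, a} E) s t" for s t
    using L that by (auto simp: rforest_def)
  \<comment> \<open>A root that reaches \<open>a\<close> in \<open>E\<close> reaches
    \<open>q\<close> over the new edge, so it is \<open>q\<close>; but \<open>q\<close> does not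
    reach \<open>a\<close> in \<open>E\<close>.\<close>
  have na: "\<not> conn E s a" if s: "s \<in> R" for s
  proof
    assume "conn E s a"
    then have "s = q"
      using uniq[OF s assms(1)] by (simp add: conn_insert_edge)
    then show False using nc \<open>conn E s a\<close> by simp
  qed
  have ex: "\<forall>v\<in>V. \<exists>t\<in>R. conn (insert {q, a} E) v t"
    using L by (simp add: rforest_def)
  have "\<exists>t\<in>insert a R. conn E v t" if "v \<in> V" for v
  proof -
    obtain t where "t \<in> R" "conn (insert {q, a} E) v t"
      using ex \<open>v \<in> V\<close> by blast
    then show ?thesis using assms(1) by (auto simp: conn_insert_edge)
  qed
  moreover have "s = t" if "s \<in> insert a R" "t \<in> insert a R" "conn E s t" for s t
    using that na uniq[of s t] conn_commute[of E] by (auto simp: conn_insert_edge)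
  ultimately show "rforest V (insert a R) E"
    using L assms bridges_insert[OF assms(4)] by (auto simp: rforest_def simple_graph_insert)
next
  assume Rt: "rforest V (insert a R) E"
  have uniq: "s = t" if "s \<in> insert a R" "t \<in> insert a R" "conn E s t" for s t
    using Rt that by (auto simp: rforest_def)
  have na: "\<not> conn E s a" "\<not> conn E a s" if "s \<in> R" for s
    using uniq[of s a] uniq[of a s] that assms(3) by auto
  have ex: "\<forall>v\<in>V. \<exists>t\<in>insert a R. conn E v t"
    using Rt unfolding rforest_def by (elim conjE)
  have "\<exists>t\<in>R. conn (insert {q, a} E) v t" if "v \<in> V" for v
  proof -
    obtain t where "t \<in> insert a R" "conn E v t"
      using ex \<open>v \<in> V\<close> by blast
    then show ?thesis
      by (intro bexI[of _ "if t = a then q else t"]) (use assms(1) in \<open>auto simp: conn_insert_edge\<close>)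
  qed
  moreover have "s = t" if "s \<in> R" "t \<in> R" "conn (insert {q, a} E) s t" for s t
    using that na uniq[of s t] by (auto simp: conn_insert_edge)
  ultimately show "rforest V R (insert {q, a} E)"
    using Rt assms na bridges_insert[OF assms(4)] by (auto simp: rforest_def simple_graph_insert)
qed

text \<open>The edges from \<open>q\<close> to \<open>N\<close> are cut one after another;
  \<open>R\<close> varies in the induction because each cut adds a root.\<close>

lemma rforest_star:
  assumes "finite N" "q \<in> R" "N \<subseteq> V" "N \<inter> R = {}" "\<And>a. a \<in> N \<Longrightarrow> {q, a} \<notin> E"
  shows "rforest V R (E \<union> (\<lambda>a. {q, a}) ` N) \<longleftrightarrow> rforest V (R \<union> N) E"
  using assms
proof (induction N arbitrary: R)
  case (insert a N)
  have "{q, a} \<notin> (\<lambda>a. {q, a}) ` N"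
    using insert.hyps(2) by (auto simp: doubleton_eq_iff)
  then have "{q, a} \<notin> E \<union> (\<lambda>a. {q, a}) ` N"
    using insert.prems(4)[of a] by simp
  then have "rforest V R (insert {q, a} (E \<union> (\<lambda>a. {q, a}) ` N)) \<longleftrightarrow>
      rforest V (insert a R) (E \<union> (\<lambda>a. {q, a}) ` N)"
    using insert by (intro rforest_insert_edge) auto
  also have "\<dots> \<longleftrightarrow> rforest V (insert a R \<union> N) E"
    using insert by (intro insert.IH) auto
  finally show ?case by simp
qed simp

lemma conn_isolated:
  assumes "\<And>e. e \<in> E \<Longrightarrow> q \<notin> e"
  shows "conn E q v \<longleftrightarrow> v = q" "conn E v q \<longleftrightarrow> v = q"
proof -
  show "conn E q v \<longleftrightarrow> v = q"
  proof
    assume "conn E q v"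
    then show "v = q" by (induction rule: conn_induct) (use assms in blast)+
  qed simp
  then show "conn E v q \<longleftrightarrow> v = q" by (simp add: conn_commute)
qed

text \<open>A root without edges is a component of its own, so it leaves the vertex set and the root
  set together.\<close>

lemma rforest_remove_isolated:
  assumes "q \<in> R" "\<And>e. e \<in> E \<Longrightarrow> q \<notin> e" "q \<in> V"
  shows "rforest V R E \<longleftrightarrow> rforest (V - {q}) (R - {q}) E"
proof -
  note [simp] = conn_isolated[OF assms(2)]
  have "simple_graph V E \<longleftrightarrow> simple_graph (V - {q}) E"
    using assms by (auto simp: simple_graph_def)
  moreover have "(\<forall>v\<in>V. \<exists>p\<in>R. conn E v p) \<longleftrightarrow> (\<forall>v\<in>V - {q}. \<exists>p\<in>R - {q}. conn E v p)"
    using assms by (metis Diff_iff conn_isolated(2) conn_refl empty_iff insert_iff)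
  moreover have "(\<forall>s\<in>R. \<forall>t\<in>R. conn E s t \<longrightarrow> s = t) \<longleftrightarrow>
      (\<forall>s\<in>R - {q}. \<forall>t\<in>R - {q}. conn E s t \<longrightarrow> s = t)"
    by (metis Diff_iff conn_isolated[OF assms(2)] singletonD)
  moreover have "R \<subseteq> V \<longleftrightarrow> R - {q} \<subseteq> V - {q}" using assms by auto
  ultimately show ?thesis unfolding rforest_def by blast
qed

text \<open>A walk that starts in \<open>V1\<close> meets no edge of \<open>E2\<close>; the
  induction carries along that its current end lies in \<open>V1\<close>.\<close>

lemma conn_Un_disjoint:
  assumes "simple_graph V1 E1" "simple_graph V2 E2" "V1 \<inter> V2 = {}" "u \<in> V1"
  shows "conn (E1 \<union> E2) u v \<longleftrightarrow> conn E1 u v"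
proof
  assume "conn (E1 \<union> E2) u v"
  then have "conn E1 u v \<and> v \<in> V1"
  proof (induction rule: conn_induct)
    case (step y z)
    have "{y, z} \<notin> E2"
    proof
      assume "{y, z} \<in> E2"
      then have "{y, z} \<subseteq> V2" using assms(2) unfolding simple_graph_def by blast
      then show False using step.IH assms(3) by auto
    qed
    then have "{y, z} \<in> E1" using step.hyps by simp
    then show ?case
      using step conn_edge[of y z E1] assms(1) conn_trans[of E1 u y z]
      by (auto simp: simple_graph_def)
  qed (use assms in simp)
  then show "conn E1 u v" ..
qed (auto elim: conn_mono)

lemma rforest_Un:
  assumes g: "simple_graph V1 E1" "simple_graph V2 E2" and dj: "V1 \<inter> V2 = {}"
    and R: "R1 \<subseteq> V1" "R2 \<subseteq> V2"
  shows "rforest (V1 \<union> V2) (R1 \<union> R2) (E1 \<union> E2) \<longleftrightarrow> rforest V1 R1 E1 \<and> rforest V2 R2 E2"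
proof -
  have c1: "conn (E1 \<union> E2) u v \<longleftrightarrow> conn E1 u v" if "u \<in> V1" for u v
    using conn_Un_disjoint[OF g dj that] .
  have c2: "conn (E1 \<union> E2) u v \<longleftrightarrow> conn E2 u v" if "u \<in> V2" for u v
    using conn_Un_disjoint[OF g(2,1) _ that] dj by (simp add: Un_commute Int_commute)
  have in1: "v \<in> V1" if "conn E1 u v" "u \<in> V1" for u v
    using conn_in_vertices[OF g(1) that] .
  have in2: "v \<in> V2" if "conn E2 u v" "u \<in> V2" for u v
    using conn_in_vertices[OF g(2) that] .
  have side: "bridges (E \<union> E') \<Longrightarrow> bridges E" for E E' :: "'a set set"
    by (erule bridges_subset) auto
  \<comment> \<open>Stated for an arbitrary pair of disjoint graphs so that it serves both orders of
    the union.\<close>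
  have half: "\<not> conn (F1 \<union> F2 - {{u, v}}) u v"
    if "simple_graph W1 F1" "simple_graph W2 F2" "W1 \<inter> W2 = {}" "bridges F1" "{u, v} \<in> F1"
    for W1 W2 F1 F2 and u v :: 'a
  proof -
    have uv: "u \<in> W1"
      using that(1,5) by (auto simp: simple_graph_def)
    have nF2: "{u, v} \<notin> F2"
    proof
      assume "{u, v} \<in> F2"
      then have "{u, v} \<subseteq> W2" using that(2) unfolding simple_graph_def by blast
      then show False using uv that(3) by auto
    qed
    have "simple_graph W1 (F1 - {{u, v}})"
      using that(1) by (auto simp: simple_graph_def)
    from conn_Un_disjoint[OF this that(2,3) uv]
    have "conn ((F1 - {{u, v}}) \<union> F2) u v \<longleftrightarrow> conn (F1 - {{u, v}}) u v" .
    moreover have "(F1 - {{u, v}}) \<union> F2 = F1 \<union> F2 - {{u, v}}" using nF2 by auto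
    ultimately show ?thesis using that(4,5) by (auto simp: bridges_def)
  qed
  have br: "bridges (E1 \<union> E2) \<longleftrightarrow> bridges E1 \<and> bridges E2"
  proof
    assume "bridges (E1 \<union> E2)"
    then show "bridges E1 \<and> bridges E2" using side[of E1 E2] side[of E2 E1] by (simp add: Un_commute)
  next
    assume b: "bridges E1 \<and> bridges E2"
    show "bridges (E1 \<union> E2)"
      unfolding bridges_def
    proof (intro allI impI)
      fix u v assume "{u, v} \<in> E1 \<union> E2"
      then show "\<not> conn (E1 \<union> E2 - {{u, v}}) u v"
        using half[OF g dj, of u v] half[OF g(2,1), of u v] b dj
        by (auto simp: Un_commute Int_commute)
    qed
  qed
  have sg: "simple_graph (V1 \<union> V2) (E1 \<union> E2)"
    using g by (auto simp: simple_graph_def)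
  have "(\<exists>q\<in>R1 \<union> R2. conn (E1 \<union> E2) v q) \<longleftrightarrow> (\<exists>q\<in>R1. conn E1 v q)" if "v \<in> V1" for v
    unfolding c1[OF that] using in1[OF _ that] R dj by blast
  moreover have "(\<exists>q\<in>R1 \<union> R2. conn (E1 \<union> E2) v q) \<longleftrightarrow> (\<exists>q\<in>R2. conn E2 v q)" if "v \<in> V2" for v
    unfolding c2[OF that] using in2[OF _ that] R dj by blast
  ultimately have ex: "(\<forall>v\<in>V1 \<union> V2. \<exists>q\<in>R1 \<union> R2. conn (E1 \<union> E2) v q) \<longleftrightarrow>
      (\<forall>v\<in>V1. \<exists>q\<in>R1. conn E1 v q) \<and> (\<forall>v\<in>V2. \<exists>q\<in>R2. conn E2 v q)"
    by (simp add: ball_Un)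
  have "(\<forall>q\<in>R1 \<union> R2. conn (E1 \<union> E2) p q \<longrightarrow> p = q) \<longleftrightarrow> (\<forall>q\<in>R1. conn E1 p q \<longrightarrow> p = q)"
    if "p \<in> R1" for p
  proof -
    have p: "p \<in> V1" using that R by auto
    show ?thesis
      unfolding c1[OF p] using in1[OF _ p] R dj by blast
  qed
  moreover have "(\<forall>q\<in>R1 \<union> R2. conn (E1 \<union> E2) p q \<longrightarrow> p = q) \<longleftrightarrow> (\<forall>q\<in>R2. conn E2 p q \<longrightarrow> p = q)"
    if "p \<in> R2" for p
  proof -
    have p: "p \<in> V2" using that R by auto
    show ?thesis
      unfolding c2[OF p] using in2[OF _ p] R dj by blast
  qed
  ultimately have un: "(\<forall>p\<in>R1 \<union> R2. \<forall>q\<in>R1 \<union> R2. conn (E1 \<union> E2) p q \<longrightarrow> p = q) \<longleftrightarrow>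
      (\<forall>p\<in>R1. \<forall>q\<in>R1. conn E1 p q \<longrightarrow> p = q) \<and> (\<forall>p\<in>R2. \<forall>q\<in>R2. conn E2 p q \<longrightarrow> p = q)"
    by (simp add: ball_Un)
  show ?thesis
    unfolding rforest_def br ex un using g sg R by auto
qed

section \<open>The recurrence and its coefficients\<close>

text \<open>
  \<open>m\<close> counts the vertices that are not roots, \<open>r\<close> the roots: deleting a root with \<open>d\<close> neighbours
  turns these into roots.
\<close>

function forest_rec :: "(nat \<Rightarrow> 'a::comm_semiring_1) \<Rightarrow> nat \<Rightarrow> nat \<Rightarrow> 'a" where
  "forest_rec x m 0 = (if m = 0 then 1 else 0)"
| "forest_rec x m (Suc r) = (\<Sum>d\<le>m. of_nat (m choose d) * x d * forest_rec x (m - d) (r + d))"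
  by pat_completeness auto
termination
  \<comment> \<open>\<open>m + r\<close> counts all vertices: a call with \<open>d \<le> m\<close>
    turns \<open>d\<close> non-roots into roots, and the total drops by one.\<close>
  by (relation "measure (\<lambda>(x, m, r). m + r)") auto

lemma sum_triangle_reindex:
  fixes h :: "nat \<Rightarrow> nat \<Rightarrow> 'a::comm_monoid_add"
  shows "(\<Sum>d\<le>m. \<Sum>j\<le>m - d. h d j) = (\<Sum>i\<le>m. \<Sum>d\<le>i. h d (i - d))"
  by (simp add: sum.Sigma, rule sum.reindex_bij_witness
      [where i = "\<lambda>(i, d). (d, i - d)" and j = "\<lambda>(d, j). (d + j, d)"]) auto

text \<open>The \<open>m\<close> non-roots are distributed between groups of \<open>r\<close> and
  \<open>s\<close> roots; equivalently, the exponential generating functions in \<open>m\<close>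
  multiply. One root of the first group is unfolded, the induction hypothesis splits what remains,
  and the sums are exchanged.\<close>

lemma forest_rec_add:
  "forest_rec x m (r + s) = (\<Sum>i\<le>m. of_nat (m choose i) * forest_rec x i r * forest_rec x (m - i) s)"
proof (induction "m + r" arbitrary: m r rule: less_induct)
  case less
  show ?case
  proof (cases r)
    case 0
    \<comment> \<open>No root can absorb no vertex, so only \<open>i = 0\<close>
      contributes.\<close>
    have "(\<Sum>i\<le>m. of_nat (m choose i) * forest_rec x i r * forest_rec x (m - i) s) =
          (\<Sum>i\<in>{0}. of_nat (m choose i) * forest_rec x i r * forest_rec x (m - i) s)"
      by (rule sum.mono_neutral_right) (auto simp: 0)
    then show ?thesis by (simp add: 0)
  next
    case (Suc r')
    let ?h = "\<lambda>d j. of_nat (m choose d) * of_nat ((m - d) choose j) * x d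
                 * forest_rec x j (r' + d) * forest_rec x (m - d - j) s"
    have "forest_rec x m (r + s) = (\<Sum>d\<le>m. of_nat (m choose d) * x d * forest_rec x (m - d) (r' + d + s))"
      by (simp add: Suc add_ac)
    also have "\<dots> = (\<Sum>d\<le>m. \<Sum>j\<le>m - d. ?h d j)"
    proof (rule sum.cong[OF refl])
      fix d assume "d \<in> {..m}"
      then have "forest_rec x (m - d) (r' + d + s) =
          (\<Sum>i\<le>m - d. of_nat ((m - d) choose i) * forest_rec x i (r' + d) * forest_rec x (m - d - i) s)"
        by (intro less) (auto simp: Suc)
      then show "of_nat (m choose d) * x d * forest_rec x (m - d) (r' + d + s) = (\<Sum>j\<le>m - d. ?h d j)"
        by (simp add: sum_distrib_left mult_ac)
    qed
    also have "\<dots> = (\<Sum>i\<le>m. \<Sum>d\<le>i. ?h d (i - d))"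
      by (rule sum_triangle_reindex)
    also have "\<dots> = (\<Sum>i\<le>m. of_nat (m choose i) * forest_rec x i r * forest_rec x (m - i) s)"
    proof (rule sum.cong[OF refl])
      fix i assume i: "i \<in> {..m}"
      have "?h d (i - d) = of_nat (m choose i) * (of_nat (i choose d) * x d * forest_rec x (i - d) (r' + d)) * forest_rec x (m - i) s"
        if "d \<in> {..i}" for d
      proof -
        \<comment> \<open>Both sides count pairs of nested sets of sizes \<open>d\<close> and
          \<open>i\<close> within \<open>m\<close> elements.\<close>
        have "(m choose d) * ((m - d) choose (i - d)) = (m choose i) * (i choose d)"
          using choose_mult[of d i m] i that by simp
        then have "of_nat (m choose d) * of_nat ((m - d) choose (i - d)) =
            (of_nat (m choose i) * of_nat (i choose d) :: 'a)"
          by (metis of_nat_mult)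
        moreover have "m - d - (i - d) = m - i" using that i by auto
        ultimately show ?thesis by (simp add: mult_ac)
      qed
      then show "(\<Sum>d\<le>i. ?h d (i - d)) = of_nat (m choose i) * forest_rec x i r * forest_rec x (m - i) s"
        by (simp add: Suc sum_distrib_left sum_distrib_right)
    qed
    finally show ?thesis .
  qed
qed

lemma sum_Pow_card:
  fixes h :: "nat \<Rightarrow> 'a::comm_semiring_1"
  assumes "finite U"
  shows "(\<Sum>N\<in>Pow U. h (card N)) = (\<Sum>d\<le>card U. of_nat (card U choose d) * h d)"
proof -
  have "(\<Sum>N\<in>Pow U. h (card N)) = (\<Sum>d\<le>card U. \<Sum>N\<in>{N\<in>Pow U. card N = d}. h (card N))"
    by (rule sum.group[symmetric]) (use assms in \<open>auto intro: card_mono\<close>)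
  also have "\<dots> = (\<Sum>d\<le>card U. of_nat (card U choose d) * h d)"
    using n_subsets[OF assms] by (simp add: Pow_def)
  finally show ?thesis .
qed

section \<open>Coefficients in the monoid algebra of multisets\<close>

definition type_weight :: "nat multiset \<Rightarrow> real" where
  "type_weight M = (\<Prod>i\<in>set_mset M. fact (count M i) * fact i ^ count M i)"

text \<open>An index missing from \<open>M\<close> contributes the factor 1, so the product may run
  over any larger finite set.\<close>

lemma type_weight_superset:
  assumes "finite A" "set_mset M \<subseteq> A"
  shows "type_weight M = (\<Prod>i\<in>A. fact (count M i) * fact i ^ count M i)"
  unfolding type_weight_def by (rule prod.mono_neutral_left) (use assms in \<open>auto simp: not_in_iff\<close>)

text \<open>Lowering the multiplicity of \<open>d\<close> by one takes the factor
  \<open>count M d\<close> out of the factorial and one factor \<open>fact d\<close> out of the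
  power.\<close>

lemma type_weight_remove:
  assumes "d \<in># M"
  shows "type_weight M = real (count M d) * fact d * type_weight (M - {#d#})"
proof -
  let ?f = "\<lambda>M i. (fact (count M i) * fact i ^ count M i :: real)"
  obtain c where c: "count M d = Suc c"
    using assms by (metis count_greater_zero_iff gr0_conv_Suc)
  have "type_weight M = ?f M d * (\<Prod>i\<in>set_mset M - {d}. ?f M i)"
    unfolding type_weight_def using assms by (simp add: prod.remove)
  moreover have "type_weight (M - {#d#}) = ?f (M - {#d#}) d * (\<Prod>i\<in>set_mset M - {d}. ?f (M - {#d#}) i)"
    using assms by (subst type_weight_superset[of "set_mset M"]) (auto simp: prod.remove dest: in_diffD)
  moreover have "(\<Prod>i\<in>set_mset M - {d}. ?f (M - {#d#}) i) = (\<Prod>i\<in>set_mset M - {d}. ?f M i)"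
    by (rule prod.cong) auto
  ultimately show ?thesis by (simp add: c)
qed

text \<open>Multiset addition is cancellative, so a monomial only shifts coefficients:
  \<open>M - K\<close> is the only candidate for the cofactor of \<open>K\<close> in
  \<open>M\<close>.\<close>

lemma lookup_single_times:
  fixes p :: "'a multiset \<Rightarrow>\<^sub>0 'b::comm_semiring_1"
  shows "Poly_Mapping.lookup (Poly_Mapping.single K 1 * p) M = (if K \<subseteq># M then Poly_Mapping.lookup p (M - K) else 0)"
proof -
  have "Poly_Mapping.lookup (Poly_Mapping.single K 1 * p) M =
      (\<Sum>l. (1 when K = l) * (\<Sum>q. Poly_Mapping.lookup p q when M = l + q))"
    by (simp add: lookup_mult lookup_single)
  also have "\<dots> = (\<Sum>q. Poly_Mapping.lookup p q when M = K + q)"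
    by (simp add: when_mult)
  also have "\<dots> = (\<Sum>q. (Poly_Mapping.lookup p q when K \<subseteq># M) when q = M - K)"
    by (rule Sum_any.cong) (auto simp: when_def)
  also have "\<dots> = (if K \<subseteq># M then Poly_Mapping.lookup p (M - K) else 0)"
    by simp
  finally show ?thesis .
qed

lemma lookup_of_nat_times:
  fixes p :: "'a::monoid_add \<Rightarrow>\<^sub>0 'b::comm_semiring_1"
  shows "Poly_Mapping.lookup (of_nat c * p) k = of_nat c * Poly_Mapping.lookup p k"
  by (induction c) (simp_all add: lookup_add algebra_simps)

lemma sum_mset_count:
  fixes M :: "nat multiset"
  shows "sum_mset M = (\<Sum>d\<in>set_mset M. count M d * d)"
proof -
  \<comment> \<open>A fixed finite index set above the support keeps the range of summation constant
    while elements are added.\<close>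
  have "sum_mset M = (\<Sum>d\<in>A. count M d * d)" if "finite A" "set_mset M \<subseteq> A" for A
    using that
  proof (induction M)
    case (add y M)
    have "count (add_mset y M) d * d = (if y = d then y else 0) + count M d * d" for d
      by simp
    then show ?case using add by (simp only: sum.distrib) simp
  qed simp
  then show ?thesis by simp
qed

text \<open>Read for forests, \<open>M\<close> lists all indegrees, zeros included, so its size is
  the number of vertices and its sum the number of edges. At \<open>m = r = 0\<close> the recurrence
  has value 1 while the closed form has the factor \<open>r = 0\<close>; hence the
  assumption.\<close>

lemma lookup_forest_rec:
  fixes M :: "nat multiset"
  assumes "m + r > 0"
  shows "Poly_Mapping.lookup (forest_rec (\<lambda>d. Poly_Mapping.single {#d#} (1::real)) m r) M =
    (if size M = m + r \<and> sum_mset M = m then real r * fact (m + r - 1) * fact m / type_weight M else 0)"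
  using assms
proof (induction "m + r" arbitrary: m r M rule: less_induct)
  case less
  let ?F = "forest_rec (\<lambda>d. Poly_Mapping.single {#d#} (1::real))"
  show ?case
  proof (cases r)
    case 0
    then show ?thesis using less.prems by simp
  next
    case (Suc s)
    have rec: "Poly_Mapping.lookup (?F m r) M =
       (\<Sum>d\<le>m. if d \<in># M then real (m choose d) * Poly_Mapping.lookup (?F (m - d) (s + d)) (M - {#d#}) else 0)"
      by (auto simp: Suc lookup_sum lookup_of_nat_times lookup_single_times mult.assoc intro!: sum.cong)
    show ?thesis
    proof (cases "m + s = 0")
      \<comment> \<open>Here the recursive call has both arguments 0, where the induction hypothesis
        does not apply; the value is computed directly.\<close>
      case True
      then have ms: "m = 0" "r = Suc 0" using Suc by auto
      then have "Poly_Mapping.lookup (?F m r) M = (if M = {#0#} then 1 else 0)"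
        by (auto simp: lookup_single when_def)
      moreover have "size M = m + r \<and> sum_mset M = m \<longleftrightarrow> M = {#0#}"
      proof
        assume *: "size M = m + r \<and> sum_mset M = m"
        then obtain a where "M = {#a#}" using ms size_1_singleton_mset[of M] by auto
        then show "M = {#0#}" using * ms by simp
      qed (simp add: ms)
      ultimately show ?thesis by (simp add: ms type_weight_def)
    next
      case False
      \<comment> \<open>Removing \<open>d\<close> lowers the size by one and the sum by
        \<open>d\<close>, so the conditions on \<open>M - {#d#}\<close> become the conditions on
        \<open>M\<close>, the same for every \<open>d\<close>.\<close>
      have IH: "Poly_Mapping.lookup (?F (m - d) (s + d)) (M - {#d#}) =
          (if size M = m + r \<and> sum_mset M = m
           then real (s + d) * fact (m + s - 1) * fact (m - d) / type_weight (M - {#d#}) else 0)"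
        if "d \<in># M" "d \<le> m" for d
      proof -
        have "sum_mset M = d + sum_mset (M - {#d#})" "size M = Suc (size (M - {#d#}))"
          using that(1) by (metis insert_DiffM sum_mset.add_mset size_add_mset)+
        then show ?thesis
          using less.hyps[of "m - d" "s + d" "M - {#d#}"] that(2) False Suc by auto
      qed
      show ?thesis
      proof (cases "size M = m + r \<and> sum_mset M = m")
        case False
        then show ?thesis by (auto simp: rec IH intro!: sum.neutral)
      next
        case True
        \<comment> \<open>Parts adding up to \<open>m\<close> are at most \<open>m\<close>, so the
          range of the recurrence covers all of \<open>set_mset M\<close>.\<close>
        have le: "d \<le> m" if "d \<in># M" for d
          using True that by (metis insert_DiffM le_add1 sum_mset.add_mset)
        have "Poly_Mapping.lookup (?F m r) M =
           (\<Sum>d\<in>set_mset M. real (m choose d) * Poly_Mapping.lookup (?F (m - d) (s + d)) (M - {#d#}))"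
          unfolding rec by (rule sum.mono_neutral_cong_right) (use le in auto)
        also have "\<dots> = (\<Sum>d\<in>set_mset M. fact m * fact (m + s - 1) / type_weight M * (real (count M d) * real (s + d)))"
        proof (rule sum.cong[OF refl])
          fix d assume d: "d \<in># M"
          have "real (m choose d) = fact m / (fact d * fact (m - d))"
            using le[OF d] by (rule binomial_fact)
          moreover have "Poly_Mapping.lookup (?F (m - d) (s + d)) (M - {#d#}) =
              real (s + d) * fact (m + s - 1) * fact (m - d) / type_weight (M - {#d#})"
            using IH[OF d le[OF d]] True by simp
          \<comment> \<open>\<open>fact (m - d)\<close> cancels within the binomial and
            \<open>fact d\<close> against \<open>type_weight_remove\<close>; only
            \<open>count M d * (s + d)\<close> still depends on \<open>d\<close>.\<close>
          ultimately show "real (m choose d) * Poly_Mapping.lookup (?F (m - d) (s + d)) (M - {#d#}) =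
              fact m * fact (m + s - 1) / type_weight M * (real (count M d) * real (s + d))"
            using d by (simp only: type_weight_remove[OF d]) (simp add: count_eq_zero_iff)
        qed
        also have "\<dots> = fact m * fact (m + s - 1) / type_weight M * (\<Sum>d\<in>set_mset M. real (count M d) * real (s + d))"
          by (simp add: sum_distrib_left)
        also have "(\<Sum>d\<in>set_mset M. real (count M d) * real (s + d)) =
            real (size M * s + sum_mset M)"
          by (simp add: size_multiset_overloaded_eq sum_mset_count sum.distrib distrib_left
              sum_distrib_right)
        \<comment> \<open>With \<open>size M = m + s + 1\<close> and sum \<open>m\<close> this is
          \<open>(m + s + 1) * s + m = (m + s) * (s + 1)\<close>; the factor \<open>m + s\<close>
          then completes the factorial.\<close>
        also have "size M * s + sum_mset M = (m + s) * r"
          using True Suc by (simp add: algebra_simps)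
        also have "fact m * fact (m + s - 1) / type_weight M * real ((m + s) * r) =
            real r * fact (m + r - 1) * fact m / type_weight M"
        proof -
          have "m + r - 1 = m + s" using Suc by simp
          moreover have "(fact (m + s) :: real) = real (m + s) * fact (m + s - 1)"
            using \<open>m + s \<noteq> 0\<close> by (intro fact_reduce) simp
          ultimately show ?thesis by (simp only: of_nat_mult times_divide_eq_left times_divide_eq_right mult_ac)
        qed
        finally show ?thesis using True by simp
      qed
    qed
  qed
qed

section \<open>Weighted sums over forests\<close>

lemma local_indegree_eq: "local_indegree E v = card {u. {u, v} \<in> E \<and> u < v}"
  by (simp add: local_indegree_def local_arcs_def)

definition forest_sum :: "(nat \<Rightarrow> 'a::comm_semiring_1) \<Rightarrow> nat set \<Rightarrow> nat set \<Rightarrow> 'a" where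
  "forest_sum x V R = (\<Sum>E | rforest V R E. \<Prod>v\<in>V. x (local_indegree E v))"

text \<open>
  Maximality of \<open>n\<close> makes its local indegree equal to its degree and keeps its edges from
  contributing to the local indegrees of other vertices.
\<close>

lemma forest_sum_remove_max:
  assumes fin: "finite V" and n: "n \<in> R" and R: "R \<subseteq> V" and max: "\<And>v. v \<in> V \<Longrightarrow> v \<le> n"
  shows "forest_sum x V R = (\<Sum>N\<in>Pow (V - R). x (card N) * forest_sum x (V - {n}) (R - {n} \<union> N))"
proof -
  let ?st = "\<lambda>N. (\<lambda>a. {n, a}) ` N"
  have nV: "n \<in> V" using n R by auto
  have avoid: "n \<notin> e" if "rforest (V - {n}) R' E'" "e \<in> E'" for R' E' e
    using that by (auto simp: rforest_def simple_graph_def)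
  have iff: "rforest V R (E' \<union> ?st N) \<longleftrightarrow> rforest (V - {n}) (R - {n} \<union> N) E'"
    if "N \<subseteq> V - R" "\<And>e. e \<in> E' \<Longrightarrow> n \<notin> e" for N E'
  proof -
    have "rforest V R (E' \<union> ?st N) \<longleftrightarrow> rforest V (R \<union> N) E'"
      using that n fin by (intro rforest_star) (auto intro: finite_subset)
    also have "\<dots> \<longleftrightarrow> rforest (V - {n}) ((R \<union> N) - {n}) E'"
      using that n nV by (intro rforest_remove_isolated) auto
    also have "(R \<union> N) - {n} = R - {n} \<union> N" using that n by auto
    finally show ?thesis .
  qed
  have split: "E = {e\<in>E. n \<notin> e} \<union> ?st {a. {n, a} \<in> E}" (is "?A E")
    and sub: "{a. {n, a} \<in> E} \<subseteq> V - R" (is "?B E") if E: "rforest V R E" for E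
  proof -
    have two: "e \<subseteq> V" "card e = 2" if "e \<in> E" for e
      using E that by (auto simp: rforest_def simple_graph_def)
    show "?A E"
    proof
      show "E \<subseteq> {e\<in>E. n \<notin> e} \<union> ?st {a. {n, a} \<in> E}"
      proof
        fix e assume e: "e \<in> E"
        then obtain u v where "e = {u, v}" using two by (meson card_2_iff)
        then show "e \<in> {e\<in>E. n \<notin> e} \<union> ?st {a. {n, a} \<in> E}"
          using e by (auto simp: insert_commute)
      qed
    qed auto
    show "?B E"
    proof
      fix a assume "a \<in> {a. {n, a} \<in> E}"
      then have a: "{n, a} \<in> E" by simp
      then have "a \<noteq> n" using two by fastforce
      \<comment> \<open>A root adjacent to \<open>n\<close> would be a second root in the component
        of \<open>n\<close>.\<close>
      moreover have "conn E n a" using a by (rule conn_edge)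
      ultimately have "a \<notin> R" using E n by (auto simp: rforest_def)
      then show "a \<in> V - R" using two[OF a] by auto
    qed
  qed
  \<comment> \<open>A forest corresponds to the neighbourhood \<open>N\<close> of \<open>n\<close>
    together with the edges avoiding \<open>n\<close>; the inverse adds the star from
    \<open>n\<close> to \<open>N\<close>.\<close>
  have "forest_sum x V R = (\<Sum>(N, E')\<in>(SIGMA N:Pow (V - R). {E'. rforest (V - {n}) (R - {n} \<union> N) E'}).
      x (card N) * (\<Prod>v\<in>V - {n}. x (local_indegree E' v)))"
    unfolding forest_sum_def
  proof (rule sum.reindex_bij_witness
      [where i = "\<lambda>(N, E'). E' \<union> ?st N" and j = "\<lambda>E. ({a. {n, a} \<in> E}, {e\<in>E. n \<notin> e})"])
    fix E assume "E \<in> {E. rforest V R E}"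
    then have E: "rforest V R E" by simp
    show "(case ({a. {n, a} \<in> E}, {e \<in> E. n \<notin> e}) of (N, E') \<Rightarrow> E' \<union> ?st N) = E"
      using split[OF E] by simp
    have "rforest (V - {n}) (R - {n} \<union> {a. {n, a} \<in> E}) {e\<in>E. n \<notin> e}"
      using iff[OF sub[OF E], of "{e\<in>E. n \<notin> e}"] E split[OF E] by simp
    then show "({a. {n, a} \<in> E}, {e\<in>E. n \<notin> e}) \<in>
        (SIGMA N:Pow (V - R). {E'. rforest (V - {n}) (R - {n} \<union> N) E'})"
      using sub[OF E] by simp
    have "u < n" if "{u, n} \<in> E" for u
    proof -
      have "{u, n} \<subseteq> V" "card {u, n} = 2" using E that by (auto simp: rforest_def simple_graph_def)
      then show ?thesis using max[of u] by (cases "u = n") auto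
    qed
    then have "{u. {u, n} \<in> E \<and> u < n} = {a. {n, a} \<in> E}"
      by (auto simp: insert_commute)
    then have "local_indegree E n = card {a. {n, a} \<in> E}"
      by (simp add: local_indegree_eq)
    moreover have "local_indegree {e\<in>E. n \<notin> e} v = local_indegree E v" if "v \<in> V - {n}" for v
    proof -
      have "{u. {u, v} \<in> {e\<in>E. n \<notin> e} \<and> u < v} = {u. {u, v} \<in> E \<and> u < v}"
        using that max[of v] by auto
      then show ?thesis by (simp add: local_indegree_eq)
    qed
    ultimately show "(case ({a. {n, a} \<in> E}, {e\<in>E. n \<notin> e}) of (N, E') \<Rightarrow>
        x (card N) * (\<Prod>v\<in>V - {n}. x (local_indegree E' v))) = (\<Prod>v\<in>V. x (local_indegree E v))"
      using fin nV by (simp add: prod.remove[of V n])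
  next
    fix p assume "p \<in> (SIGMA N:Pow (V - R). {E'. rforest (V - {n}) (R - {n} \<union> N) E'})"
    then obtain N E' where p: "p = (N, E')" "N \<subseteq> V - R" "rforest (V - {n}) (R - {n} \<union> N) E'"
      by auto
    note av = avoid[OF p(3)]
    have "{a. {n, a} \<in> E' \<union> ?st N} = N"
      using av by (auto simp: doubleton_eq_iff)
    moreover have "{e \<in> E' \<union> ?st N. n \<notin> e} = E'"
      using av by auto
    ultimately show "({a. {n, a} \<in> (case p of (N, E') \<Rightarrow> E' \<union> ?st N)},
        {e \<in> (case p of (N, E') \<Rightarrow> E' \<union> ?st N). n \<notin> e}) = p"
      by (simp add: p(1))
    show "(case p of (N, E') \<Rightarrow> E' \<union> ?st N) \<in> {E. rforest V R E}"
      using iff[OF p(2) av] p by simp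
  qed
  also have "\<dots> = (\<Sum>N\<in>Pow (V - R). x (card N) * forest_sum x (V - {n}) (R - {n} \<union> N))"
    using fin by (simp add: sum.Sigma[symmetric] finite_rforests forest_sum_def sum_distrib_left)
  finally show ?thesis .
qed

text \<open>\<open>S\<close> is the set of non-roots in the component of \<open>q\<close>; the edges
  outside form a forest for the other roots. The weight factors because a local indegree depends
  only on the edges at the vertex.\<close>

lemma forest_sum_split_component:
  assumes fin: "finite V" and q: "q \<in> R" and R: "R \<subseteq> V"
  shows "forest_sum x V R = (\<Sum>S\<in>Pow (V - R).
    forest_sum x (insert q S) {q} * forest_sum x (V - insert q S) (R - {q}))"
proof -
  let ?F1 = "\<lambda>S. {E. rforest (insert q S) {q} E}"
  let ?F2 = "\<lambda>S. {E. rforest (V - insert q S) (R - {q}) E}"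
  let ?w = "\<lambda>V E. \<Prod>v\<in>V. x (local_indegree E v)"
  define K where "K E = {v. conn E q v}" for E
  have qV: "q \<in> V" using q R by auto
  have qK: "q \<in> K E" for E by (simp add: K_def)
  have iff: "rforest V R (E1 \<union> E2) \<longleftrightarrow> E1 \<in> ?F1 S \<and> E2 \<in> ?F2 S"
    if "S \<subseteq> V - R" "simple_graph (insert q S) E1" "simple_graph (V - insert q S) E2" for S E1 E2
  proof -
    have "insert q S \<union> (V - insert q S) = V" "{q} \<union> (R - {q}) = R"
      using that(1) q qV by auto
    moreover have "rforest (insert q S \<union> (V - insert q S)) ({q} \<union> (R - {q})) (E1 \<union> E2) \<longleftrightarrow>
        rforest (insert q S) {q} E1 \<and> rforest (V - insert q S) (R - {q}) E2"
      using that R by (intro rforest_Un) auto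
    ultimately show ?thesis by simp
  qed
  have weight: "?w V (E1 \<union> E2) = ?w (insert q S) E1 * ?w (V - insert q S) E2"
    if "S \<subseteq> V - R" "simple_graph (insert q S) E1" "simple_graph (V - insert q S) E2" for S E1 E2
  proof -
    have "local_indegree (E1 \<union> E2) v = local_indegree E1 v" if "v \<in> insert q S" for v
    proof -
      have "{u, v} \<notin> E2" for u
        using that \<open>simple_graph (V - insert q S) E2\<close> unfolding simple_graph_def by blast
      then show ?thesis by (simp add: local_indegree_eq)
    qed
    moreover have "local_indegree (E1 \<union> E2) v = local_indegree E2 v" if "v \<in> V - insert q S" for v
    proof -
      have "{u, v} \<notin> E1" for u
        using that \<open>simple_graph (insert q S) E1\<close> unfolding simple_graph_def by blast
      then show ?thesis by (simp add: local_indegree_eq)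
    qed
    moreover have "?w V (E1 \<union> E2) = ?w (V - insert q S) (E1 \<union> E2) * ?w (insert q S) (E1 \<union> E2)"
      using that(1) qV fin by (intro prod.subset_diff) auto
    ultimately show ?thesis by (simp add: mult.commute)
  qed
  have dec: "K E - {q} \<subseteq> V - R" "insert q (K E - {q}) = K E"
      "simple_graph (K E) {e\<in>E. e \<subseteq> K E}" "simple_graph (V - K E) {e\<in>E. e \<inter> K E = {}}"
      "{e\<in>E. e \<subseteq> K E} \<union> {e\<in>E. e \<inter> K E = {}} = E" if E: "rforest V R E" for E
  proof -
    have sg: "simple_graph V E" using E by (simp add: rforest_def)
    have KV: "K E \<subseteq> V" using conn_in_vertices[OF sg _ qV] by (auto simp: K_def)
    have "v = q" if "v \<in> K E" "v \<in> R" for v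
      using E that q by (auto simp: rforest_def K_def)
    then show "K E - {q} \<subseteq> V - R" using KV by auto
    show "insert q (K E - {q}) = K E" using qK by auto
    show "simple_graph (K E) {e\<in>E. e \<subseteq> K E}" "simple_graph (V - K E) {e\<in>E. e \<inter> K E = {}}"
      using sg KV by (auto simp: simple_graph_def intro: finite_subset)
    have "e \<subseteq> K E \<or> e \<inter> K E = {}" if e: "e \<in> E" for e
    proof -
      obtain u v where uv: "e = {u, v}"
        using sg e unfolding simple_graph_def by (meson card_2_iff)
      have "u \<in> K E \<longleftrightarrow> v \<in> K E"
        using conn_edge[of u v E] e unfolding K_def uv by (auto dest: conn_sym intro: conn_trans)
      then show ?thesis using uv by auto
    qed
    then show "{e\<in>E. e \<subseteq> K E} \<union> {e\<in>E. e \<inter> K E = {}} = E" by blast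
  qed
  have "forest_sum x V R = (\<Sum>(S, E1, E2)\<in>(SIGMA S:Pow (V - R). ?F1 S \<times> ?F2 S).
      ?w (insert q S) E1 * ?w (V - insert q S) E2)"
    unfolding forest_sum_def
  proof (rule sum.reindex_bij_witness
      [where i = "\<lambda>(S, E1, E2). E1 \<union> E2"
        and j = "\<lambda>E. (K E - {q}, {e\<in>E. e \<subseteq> K E}, {e\<in>E. e \<inter> K E = {}})"])
    fix E assume "E \<in> {E. rforest V R E}"
    then have E: "rforest V R E" by simp
    note d = dec[OF E]
    show "(case (K E - {q}, {e\<in>E. e \<subseteq> K E}, {e\<in>E. e \<inter> K E = {}}) of (S, E1, E2) \<Rightarrow> E1 \<union> E2) = E"
      using d(5) by simp
    show "(K E - {q}, {e\<in>E. e \<subseteq> K E}, {e\<in>E. e \<inter> K E = {}}) \<in> (SIGMA S:Pow (V - R). ?F1 S \<times> ?F2 S)"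
      using iff[of "K E - {q}", unfolded d(2), OF d(1,3,4)] d(1,2,5) E by simp
    show "(case (K E - {q}, {e\<in>E. e \<subseteq> K E}, {e\<in>E. e \<inter> K E = {}}) of (S, E1, E2) \<Rightarrow>
        ?w (insert q S) E1 * ?w (V - insert q S) E2) = ?w V E"
      using weight[of "K E - {q}", unfolded d(2), OF d(1,3,4)] d(2,5) by simp
  next
    fix p assume "p \<in> (SIGMA S:Pow (V - R). ?F1 S \<times> ?F2 S)"
    then obtain S E1 E2 where p: "p = (S, E1, E2)" and S: "S \<subseteq> V - R"
      and E: "rforest (insert q S) {q} E1" "rforest (V - insert q S) (R - {q}) E2"
      by auto
    have g: "simple_graph (insert q S) E1" "simple_graph (V - insert q S) E2"
      using E by (auto simp: rforest_def)
    \<comment> \<open>In \<open>E1\<close> every vertex of \<open>insert q S\<close> reaches its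
      only root \<open>q\<close>, and \<open>E2\<close> adds nothing reachable; so \<open>S\<close>
      is recovered from the union.\<close>
    have "conn (E1 \<union> E2) q v \<longleftrightarrow> v \<in> insert q S" for v
    proof -
      have "conn (E1 \<union> E2) q v \<longleftrightarrow> conn E1 q v"
        by (rule conn_Un_disjoint[OF g]) auto
      also have "\<dots> \<longleftrightarrow> v \<in> insert q S"
        using conn_in_vertices[OF g(1), of q v] E(1) conn_sym[of E1 v q] by (auto simp: rforest_def)
      finally show ?thesis .
    qed
    then have KS: "K (E1 \<union> E2) = insert q S" by (auto simp: K_def)
    have "q \<notin> S" using S q by auto
    \<comment> \<open>Edges are nonempty, so lying inside \<open>insert q S\<close> and being
      disjoint from it exclude each other; this recovers \<open>E1\<close> and
      \<open>E2\<close>.\<close>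
    have in1: "e \<subseteq> insert q S" "e \<noteq> {}" if "e \<in> E1" for e
      using g(1) that by (auto simp: simple_graph_def)
    have in2: "e \<inter> insert q S = {}" "e \<noteq> {}" if "e \<in> E2" for e
      using g(2) that unfolding simple_graph_def by fastforce+
    have out1: "e \<inter> insert q S \<noteq> {}" if "e \<in> E1" for e
      using in1[OF that] by auto
    have out2: "\<not> e \<subseteq> insert q S" if "e \<in> E2" for e
      using in2[OF that] by auto
    have "{e \<in> E1 \<union> E2. e \<subseteq> insert q S} = E1"
      using in1(1) out2 by auto
    moreover have "{e \<in> E1 \<union> E2. e \<inter> insert q S = {}} = E2"
      using in2(1) out1 by auto
    ultimately show "(K (case p of (S, E1, E2) \<Rightarrow> E1 \<union> E2) - {q},
        {e \<in> (case p of (S, E1, E2) \<Rightarrow> E1 \<union> E2). e \<subseteq> K (case p of (S, E1, E2) \<Rightarrow> E1 \<union> E2)},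
        {e \<in> (case p of (S, E1, E2) \<Rightarrow> E1 \<union> E2). e \<inter> K (case p of (S, E1, E2) \<Rightarrow> E1 \<union> E2) = {}}) = p"
      using \<open>q \<notin> S\<close> by (simp only: p prod.case KS) simp
    show "(case p of (S, E1, E2) \<Rightarrow> E1 \<union> E2) \<in> {E. rforest V R E}"
      using iff[OF S g] E p by simp
  qed
  also have "\<dots> = (\<Sum>S\<in>Pow (V - R). \<Sum>(E1, E2)\<in>?F1 S \<times> ?F2 S. ?w (insert q S) E1 * ?w (V - insert q S) E2)"
    using fin by (subst sum.Sigma) (auto simp: finite_rforests)
  also have "\<dots> = (\<Sum>S\<in>Pow (V - R). forest_sum x (insert q S) {q} * forest_sum x (V - insert q S) (R - {q}))"
    by (simp only: forest_sum_def sum_product sum.cartesian_product)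
  finally show ?thesis .
qed

text \<open>In a tree any vertex can serve as the only root without changing an edge. Local
  indegrees ignore the root, so it may be moved to the largest vertex without changing the
  weight.\<close>

lemma rforest_reroot:
  assumes "p \<in> V" "q \<in> V"
  shows "rforest V {p} E \<longleftrightarrow> rforest V {q} E"
  using assms unfolding rforest_def by (auto intro: conn_trans conn_sym)

lemma forest_sum_eq_forest_rec:
  assumes "finite V" "R \<subseteq> V"
  shows "forest_sum x V R = forest_rec x (card (V - R)) (card R)"
  using assms
proof (induction "card V" arbitrary: V R rule: less_induct)
  case less
  have finR: "finite R" using less.prems by (rule finite_subset[rotated])
  consider "R = {}" | q where "R = {q}" | "card R \<ge> 2"
  proof -
    have "card R = 0 \<or> card R = 1 \<or> card R \<ge> 2" by arith
    then show ?thesis using that finR by (metis card_0_eq card_1_singletonE)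
  qed
  then show ?case
  proof cases
    case 1
    show ?thesis
    proof (cases "V = {}")
      case True
      have "{E :: nat set set. rforest {} {} E} = {{}}"
        by (auto simp: rforest_def simple_graph_def bridges_def)
      then show ?thesis using 1 True by (simp add: forest_sum_def)
    next
      case False
      then have "{E. rforest V {} E} = {}" by (auto simp: rforest_def)
      then show ?thesis using 1 False less.prems by (simp add: forest_sum_def)
    qed
  next
    case 2
    define n where "n = Max V"
    have nV: "n \<in> V" and max: "\<And>v. v \<in> V \<Longrightarrow> v \<le> n"
      using 2 less.prems by (auto simp: n_def intro: Max_in)
    define m where "m = card (V - {n})"
    have "card V = Suc m" using card.remove[OF less.prems(1) nV] by (simp add: m_def)
    have "forest_sum x V R = forest_sum x V {n}"
      using rforest_reroot[of q V n] 2 nV less.prems by (simp add: forest_sum_def)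
    also have "\<dots> = (\<Sum>N\<in>Pow (V - {n}). x (card N) * forest_sum x (V - {n}) N)"
      using less.prems nV max by (subst forest_sum_remove_max[of V n]) auto
    also have "\<dots> = (\<Sum>N\<in>Pow (V - {n}). x (card N) * forest_rec x (m - card N) (card N))"
    proof (rule sum.cong[OF refl])
      fix N assume N: "N \<in> Pow (V - {n})"
      then have "finite N" using less.prems by (auto intro: finite_subset)
      then have "card (V - {n} - N) = m - card N"
        unfolding m_def using N by (intro card_Diff_subset) auto
      moreover have "forest_sum x (V - {n}) N = forest_rec x (card (V - {n} - N)) (card N)"
        using N less.prems nV \<open>card V = Suc m\<close> by (intro less.hyps) auto
      ultimately show "x (card N) * forest_sum x (V - {n}) N = x (card N) * forest_rec x (m - card N) (card N)"
        by simp
    qed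
    \<comment> \<open>Grouping the sets \<open>N\<close> by size gives the defining sum of
      \<open>forest_rec\<close> for a single root.\<close>
    also have "\<dots> = forest_rec x m 1"
      using less.prems sum_Pow_card[of "V - {n}" "\<lambda>d. x d * forest_rec x (m - d) d"]
      by (simp add: m_def mult.assoc)
    also have "m = card (V - R)"
      using \<open>card V = Suc m\<close> 2 less.prems by (simp add: card_Diff_subset)
    finally show ?thesis using 2 by simp
  next
    case 3
    then obtain q where q: "q \<in> R" by fastforce
    define m where "m = card (V - R)"
    have cR: "card R = 1 + card (R - {q})" using card.remove[OF finR q] by simp
    have "forest_sum x V R = (\<Sum>S\<in>Pow (V - R).
        forest_sum x (insert q S) {q} * forest_sum x (V - insert q S) (R - {q}))"
      by (rule forest_sum_split_component) (use less.prems q in auto)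
    also have "\<dots> = (\<Sum>S\<in>Pow (V - R). forest_rec x (card S) 1 * forest_rec x (m - card S) (card (R - {q})))"
    proof (rule sum.cong[OF refl])
      fix S assume S: "S \<in> Pow (V - R)"
      then have fS: "finite S" using less.prems by (auto intro: finite_subset)
      \<comment> \<open>A second root lies outside \<open>insert q S\<close>, so the tree of
        \<open>q\<close> has fewer vertices and the induction hypothesis applies.\<close>
      obtain p where p: "p \<in> R" "p \<noteq> q"
        using cR 3 by (metis Diff_iff One_nat_def Suc_1 add_le_cancel_left card.empty ex_in_conv
            insertI1 not_one_le_zero plus_1_eq_Suc)
      have "insert q S \<subset> V" using p q S less.prems by auto
      then have "card (insert q S) < card V" using less.prems by (intro psubset_card_mono)
      then have "forest_sum x (insert q S) {q} = forest_rec x (card (insert q S - {q})) (card {q})"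
        by (intro less.hyps) (use fS in auto)
      moreover have "insert q S - {q} = S" using S q by auto
      moreover have "card (V - insert q S) < card V"
        using q less.prems by (intro psubset_card_mono) auto
      then have "forest_sum x (V - insert q S) (R - {q}) =
          forest_rec x (card (V - insert q S - (R - {q}))) (card (R - {q}))"
        by (intro less.hyps) (use less.prems S in auto)
      moreover have "V - insert q S - (R - {q}) = V - R - S" using q by auto
      moreover have "card (V - R - S) = m - card S"
        unfolding m_def using fS S by (intro card_Diff_subset) auto
      ultimately show "forest_sum x (insert q S) {q} * forest_sum x (V - insert q S) (R - {q}) =
          forest_rec x (card S) 1 * forest_rec x (m - card S) (card (R - {q}))"
        by simp
    qed
    also have "\<dots> = forest_rec x m (1 + card (R - {q}))"
      using less.prems sum_Pow_card[of "V - R" "\<lambda>i. forest_rec x i 1 * forest_rec x (m - i) (card (R - {q}))"]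
      unfolding forest_rec_add by (simp add: m_def mult.assoc)
    finally show ?thesis by (simp add: cR m_def)
  qed
qed

section \<open>Counting by type\<close>

text \<open>Makes the weight of a forest a single monomial that records the multiset of all its
  local indegrees.\<close>

lemma prod_single:
  "(\<Prod>v\<in>A. Poly_Mapping.single {#f v#} (1::'b::comm_semiring_1)) =
     Poly_Mapping.single (image_mset f (mset_set A)) 1"
proof (induction A rule: infinite_finite_induct)
  case (insert a A)
  then show ?case by (simp add: mult_single)
qed simp_all

text \<open>Each forest contributes one monomial with coefficient 1, so the coefficient of the total
  weight at \<open>M\<close> is the number of forests sought.\<close>

lemma card_rforests:
  assumes "1 \<le> r" "r \<le> n" "size M = n" "sum_mset M = n - r"
  shows "real (card {E. rforest {1..n} {1..r} E \<and> image_mset (local_indegree E) (mset_set {1..n}) = M}) =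
    real r * fact (n - 1) * fact (n - r) / type_weight M"
proof -
  let ?x = "\<lambda>d. Poly_Mapping.single {#d#} (1::real)"
  let ?F = "{E. rforest {1..n} {1..r} E}"
  let ?t = "\<lambda>E. image_mset (local_indegree E) (mset_set {1..n})"
  have "{1..n} - {1..r} = {Suc r..n}" by auto
  then have cd: "card ({1..n} - {1..r}) = n - r" by simp
  have "forest_sum ?x {1..n} {1..r} = forest_rec ?x (n - r) r"
    using forest_sum_eq_forest_rec[of "{1..n}" "{1..r}" ?x] assms cd by simp
  then have "Poly_Mapping.lookup (forest_sum ?x {1..n} {1..r}) M =
      real r * fact (n - 1) * fact (n - r) / type_weight M"
    using assms by (simp add: lookup_forest_rec)
  moreover have "Poly_Mapping.lookup (forest_sum ?x {1..n} {1..r}) M = (\<Sum>E\<in>?F. if ?t E = M then 1 else 0)"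
    by (simp add: forest_sum_def prod_single lookup_sum lookup_single when_def)
  moreover have "\<dots> = real (card {E\<in>?F. ?t E = M})"
    by (simp add: sum.If_cases finite_rforests Int_def)
  ultimately show ?thesis by simp
qed

text \<open>The type drops the zero indegrees, but there are \<open>n\<close> vertices in all, so
  their number is recovered as \<open>n - size lam\<close>.\<close>

lemma local_type_eq_iff:
  assumes "\<forall>i\<in>#lam. i \<ge> 1" "size lam \<le> n"
  shows "local_type n E = lam \<longleftrightarrow>
    image_mset (local_indegree E) (mset_set {1..n}) = lam + replicate_mset (n - size lam) 0"
    (is "_ \<longleftrightarrow> ?t = _")
proof
  assume L: "local_type n E = lam"
  have zeros: "filter_mset (\<lambda>d. \<not> d \<ge> 1) X = replicate_mset (count X 0) 0" for X :: "nat multiset"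
    by (rule multiset_eqI) (simp add: not_le)
  have "?t = filter_mset (\<lambda>d. d \<ge> 1) ?t + filter_mset (\<lambda>d. \<not> d \<ge> 1) ?t"
    by (rule multiset_partition)
  also have "filter_mset (\<lambda>d. d \<ge> 1) ?t = lam"
    using L unfolding local_type_def .
  also note zeros
  finally have t: "?t = lam + replicate_mset (count ?t 0) 0" .
  have "n = size ?t" by simp
  also have "\<dots> = size lam + count ?t 0" by (subst t) simp
  finally have "count ?t 0 = n - size lam" by simp
  then show "?t = lam + replicate_mset (n - size lam) 0" using t by metis
next
  assume t: "?t = lam + replicate_mset (n - size lam) 0"
  have "filter_mset (\<lambda>d. d \<ge> 1) lam = lam"
    using assms(1) by (simp add: filter_mset_eq_conv)
  moreover have "filter_mset (\<lambda>d. d \<ge> 1) (replicate_mset k (0::nat)) = {#}" for k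
    by (induction k) auto
  ultimately show "local_type n E = lam"
    by (simp only: local_type_def t filter_union_mset add_0_right)
qed

theorem theorem2:
  fixes n r :: nat and lam :: "nat multiset" and e :: "nat \<Rightarrow> nat"
  assumes "1 \<le> r" and "r \<le> n"
    and "is_partition (n - r) lam"
    and "\<And>i. i \<ge> 1 \<Longrightarrow> e i = count lam i"
    and "e 0 = n - (\<Sum>i = 1..n - r. e i)"
  shows "real (card {E. rooted_labeled_forest n r E \<and> local_type n E = lam}) =
    real r * fact (n - 1) * fact (n - r) / (\<Prod>i = 0..n - r. fact (e i) * fact i ^ e i)"
proof -
  have pos: "\<forall>i\<in>#lam. i \<ge> 1" and sum: "sum_mset lam = n - r"
    using assms(3) by (auto simp: is_partition_def)
  have le: "i \<le> n - r" if "i \<in># lam" for i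
    using sum that by (metis insert_DiffM le_add1 sum_mset.add_mset)
  have "size lam = (\<Sum>i\<in>set_mset lam. count lam i)" by (rule size_multiset_overloaded_eq)
  also have "\<dots> = (\<Sum>i = 1..n - r. e i)"
    using le pos assms(4) by (intro sum.mono_neutral_cong_left) (auto simp: not_in_iff)
  finally have size: "(\<Sum>i = 1..n - r. e i) = size lam" ..
  \<comment> \<open>Positive parts give \<open>size lam \<le> n\<close>, so the subtraction in
    \<open>e 0\<close> is not truncated.\<close>
  have "size lam \<le> sum_mset lam"
    unfolding size_multiset_overloaded_eq sum_mset_count using pos by (intro sum_mono) auto
  then have szn: "size lam \<le> n" using sum by simp
  \<comment> \<open>Restores the vertices of indegree 0, whose number is \<open>e 0\<close>.\<close>
  define M where "M = lam + replicate_mset (n - size lam) 0"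
  have cnt: "count M i = e i" for i
  proof (cases "i = 0")
    case True
    then have "count lam i = 0" using pos by (auto simp: count_eq_zero_iff)
    then show ?thesis using True assms(5) size by (simp add: M_def)
  next
    case False
    then show ?thesis using assms(4)[of i] by (simp add: M_def)
  qed
  have "type_weight M = (\<Prod>i = 0..n - r. fact (e i) * fact i ^ e i)"
    unfolding cnt[symmetric] by (rule type_weight_superset) (use le in \<open>auto simp: M_def split: if_splits\<close>)
  moreover have "size M = n" "sum_mset M = n - r"
    using szn sum by (simp_all add: M_def)
  ultimately show ?thesis
    using card_rforests[OF assms(1,2), of M]
    by (simp add: rooted_labeled_forest_iff[OF assms(2)] local_type_eq_iff[OF pos szn] M_def)
qed

end
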